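(* Let $(\mathscr{C},\otimes_h,\otimes_v)$ be a two-fold monoidal category which is strictly associative and has strict interchange, but only weak units. Then $\mathscr{C}$ is degenerate symmetric: with $\otimes = \otimes_h$, there exists a symmetry $\sigma$ on the monoidal category $(\mathscr{C},\otimes)$ such that $\sigma_{X,X} = \mathrm{id}_{X\otimes X}$ for every object $X$ of $\mathscr{C}$.
   Context: Here a two-fold monoidal category, strictly associative, with strict interchange and weak units, means: a category $\mathscr{C}$ with two functors $\otimes_h,\otimes_v:\mathscr{C}\times\mathscr{C}\to\mathscr{C}$, each strictly associative (on objects and on arrows), satisfying the strict interchange law $(X\otimes_h Y)\otimes_v(Z\otimes_h W) = (X\otimes_v Z)\otimes_h(Y\otimes_v W)$ for all objects and for all arrows, and such that each of $\otimes_h$ and $\otimes_v$ has a weak unit. A weak unit for a strictly associative $\otimes$ is an object $I$ equipped with natural isomorphisms $\lambda_X: I\otimes X\to X$ and $\rho_X: X\otimes I\to X$ such that $\mathrm{id}_X\otimes\lambda_Y = \rho_X\otimes\mathrm{id}_Y$ for all objects $X,Y$. No further compatibility between the two weak units is required. A symmetry on a strictly associative monoidal category $(\mathscr{C},\otimes)$ (with weak unit) is a family of isomorphisms $\sigma_{X,Y}:X\otimes Y\to Y\otimes X$, natural in $X$ and $Y$, with $\sigma_{Y,X}\circ\sigma_{X,Y}=\mathrm{id}_{X\otimes Y}$ and $\sigma_{X,Y\otimes Z} = (\mathrm{id}_Y\otimes\sigma_{X,Z})\circ(\sigma_{X,Y}\otimes\mathrm{id}_Z)$ for all objects $X,Y,Z$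 (compatibility with the unit is automatic). *)

theory Defs
  imports Main
begin

section \<open>Categories, functors and natural isomorphisms\<close>

text \<open>
  A category is given by a set of objects and a set of arrows inside arbitrary types.
  The operations are total functions in HOL; nothing is required of them outside these
  sets, nor of \<open>Comp C g f\<close> unless \<open>g\<close> and \<open>f\<close> are composable. Accordingly, all
  equations below, in particular strict associativity and strict interchange, are
  imposed only on members of these sets.
\<close>

record ('o, 'a) category =
  Obj :: "'o set"
  Arr :: "'a set"
  Dom :: "'a \<Rightarrow> 'o"
  Cod :: "'a \<Rightarrow> 'o"
  Ident :: "'o \<Rightarrow> 'a"
  Comp :: "'a \<Rightarrow> 'a \<Rightarrow> 'a"  (infixl \<open>\<cdot>\<index>\<close> 55)

locale category =
  fixes C :: "('o, 'a) category" (structure)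
  assumes Dom_in: "f \<in> Arr C \<Longrightarrow> Dom C f \<in> Obj C"
    and Cod_in: "f \<in> Arr C \<Longrightarrow> Cod C f \<in> Obj C"
    and Ident_in: "X \<in> Obj C \<Longrightarrow> Ident C X \<in> Arr C"
    and Dom_Ident: "X \<in> Obj C \<Longrightarrow> Dom C (Ident C X) = X"
    and Cod_Ident: "X \<in> Obj C \<Longrightarrow> Cod C (Ident C X) = X"
    and Comp_in: "\<lbrakk>f \<in> Arr C; g \<in> Arr C; Cod C f = Dom C g\<rbrakk> \<Longrightarrow> g \<cdot> f \<in> Arr C"
    and Dom_Comp: "\<lbrakk>f \<in> Arr C; g \<in> Arr C; Cod C f = Dom C g\<rbrakk> \<Longrightarrow> Dom C (g \<cdot> f) = Dom C f"
    and Cod_Comp: "\<lbrakk>f \<in> Arr C; g \<in> Arr C; Cod C f = Dom C g\<rbrakk> \<Longrightarrow> Cod C (g \<cdot> f) = Cod C g"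
    and Comp_Ident_right: "f \<in> Arr C \<Longrightarrow> f \<cdot> Ident C (Dom C f) = f"
    and Comp_Ident_left: "f \<in> Arr C \<Longrightarrow> Ident C (Cod C f) \<cdot> f = f"
    and Comp_assoc:
      "\<lbrakk>f \<in> Arr C; g \<in> Arr C; h \<in> Arr C; Cod C f = Dom C g; Cod C g = Dom C h\<rbrakk>
        \<Longrightarrow> h \<cdot> (g \<cdot> f) = (h \<cdot> g) \<cdot> f"

definition Hom :: "('o, 'a) category \<Rightarrow> 'o \<Rightarrow> 'o \<Rightarrow> 'a set" where
  "Hom C X Y = {f \<in> Arr C. Dom C f = X \<and> Cod C f = Y}"

definition is_iso :: "('o, 'a) category \<Rightarrow> 'a \<Rightarrow> bool" where
  "is_iso C f \<longleftrightarrow> f \<in> Arr C \<and>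
     (\<exists>g \<in> Hom C (Cod C f) (Dom C f).
        g \<cdot>\<^bsub>C\<^esub> f = Ident C (Dom C f) \<and> f \<cdot>\<^bsub>C\<^esub> g = Ident C (Cod C f))"

definition prod_category ::
    "('o, 'a) category \<Rightarrow> ('p, 'b) category \<Rightarrow> ('o \<times> 'p, 'a \<times> 'b) category" where
  "prod_category C D =
    \<lparr>Obj = Obj C \<times> Obj D,
     Arr = Arr C \<times> Arr D,
     Dom = map_prod (Dom C) (Dom D),
     Cod = map_prod (Cod C) (Cod D),
     Ident = map_prod (Ident C) (Ident D),
     Comp = (\<lambda>(g, g') (f, f'). (g \<cdot>\<^bsub>C\<^esub> f, g' \<cdot>\<^bsub>D\<^esub> f'))\<rparr>"

record ('o, 'a, 'p, 'b) functor_data =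
  ob_map :: "'o \<Rightarrow> 'p"
  ar_map :: "'a \<Rightarrow> 'b"

locale is_functor = dom: category C + cod: category D
  for C :: "('o, 'a) category" and D :: "('p, 'b) category"
    and F :: "('o, 'a, 'p, 'b) functor_data" +
  assumes ob_map_in: "X \<in> Obj C \<Longrightarrow> ob_map F X \<in> Obj D"
    and ar_map_in:
      "f \<in> Arr C \<Longrightarrow> ar_map F f \<in> Hom D (ob_map F (Dom C f)) (ob_map F (Cod C f))"
    and ar_map_Ident: "X \<in> Obj C \<Longrightarrow> ar_map F (Ident C X) = Ident D (ob_map F X)"
    and ar_map_Comp:
      "\<lbrakk>f \<in> Arr C; g \<in> Arr C; Cod C f = Dom C g\<rbrakk>
        \<Longrightarrow> ar_map F (g \<cdot>\<^bsub>C\<^esub> f) = ar_map F g \<cdot>\<^bsub>D\<^esub> ar_map F f"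

definition id_functor :: "('o, 'a, 'o, 'a) functor_data" where
  "id_functor = \<lparr>ob_map = (\<lambda>X. X), ar_map = (\<lambda>f. f)\<rparr>"

locale natural_iso = dom_functor: is_functor C D F + cod_functor: is_functor C D G
  for C :: "('o, 'a) category" and D :: "('p, 'b) category"
    and F G :: "('o, 'a, 'p, 'b) functor_data"
    and \<tau> :: "'o \<Rightarrow> 'b" +
  assumes component_in: "X \<in> Obj C \<Longrightarrow> \<tau> X \<in> Hom D (ob_map F X) (ob_map G X)"
    and component_iso: "X \<in> Obj C \<Longrightarrow> is_iso D (\<tau> X)"
    and natural:
      "f \<in> Arr C \<Longrightarrow>
        \<tau> (Cod C f) \<cdot>\<^bsub>D\<^esub> ar_map F f = ar_map G f \<cdot>\<^bsub>D\<^esub> \<tau> (Dom C f)"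


section \<open>Strictly associative tensor products with weak units\<close>

type_synonym ('o, 'a) tensor = "('o \<times> 'o, 'a \<times> 'a, 'o, 'a) functor_data"

text \<open>The tensor product is written \<open>\<otimes>\<close> on objects and \<open>\<odot>\<close> on arrows.\<close>

abbreviation tensor_ob :: "'o \<Rightarrow> ('o, 'a) tensor \<Rightarrow> 'o \<Rightarrow> 'o"
    (\<open>(_ \<otimes>\<^bsub>_\<^esub> _)\<close> [70, 0, 71] 70) where
  "X \<otimes>\<^bsub>T\<^esub> Y \<equiv> ob_map T (X, Y)"

abbreviation tensor_ar :: "'a \<Rightarrow> ('o, 'a) tensor \<Rightarrow> 'a \<Rightarrow> 'a"
    (\<open>(_ \<odot>\<^bsub>_\<^esub> _)\<close> [70, 0, 71] 70) where
  "f \<odot>\<^bsub>T\<^esub> g \<equiv> ar_map T (f, g)"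

locale strict_tensor = is_functor "prod_category C C" C T
  for C :: "('o, 'a) category" and T :: "('o, 'a) tensor" +
  assumes assoc_ob:
      "\<lbrakk>X \<in> Obj C; Y \<in> Obj C; Z \<in> Obj C\<rbrakk>
        \<Longrightarrow> (X \<otimes>\<^bsub>T\<^esub> Y) \<otimes>\<^bsub>T\<^esub> Z = X \<otimes>\<^bsub>T\<^esub> (Y \<otimes>\<^bsub>T\<^esub> Z)"
    and assoc_ar:
      "\<lbrakk>f \<in> Arr C; g \<in> Arr C; h \<in> Arr C\<rbrakk>
        \<Longrightarrow> (f \<odot>\<^bsub>T\<^esub> g) \<odot>\<^bsub>T\<^esub> h = f \<odot>\<^bsub>T\<^esub> (g \<odot>\<^bsub>T\<^esub> h)"

definition tensor_left ::
    "('o, 'a) category \<Rightarrow> ('o, 'a) tensor \<Rightarrow> 'o \<Rightarrow> ('o, 'a, 'o, 'a) functor_data" where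
  "tensor_left C T I =
    \<lparr>ob_map = (\<lambda>X. I \<otimes>\<^bsub>T\<^esub> X), ar_map = (\<lambda>f. Ident C I \<odot>\<^bsub>T\<^esub> f)\<rparr>"

definition tensor_right ::
    "('o, 'a) category \<Rightarrow> ('o, 'a) tensor \<Rightarrow> 'o \<Rightarrow> ('o, 'a, 'o, 'a) functor_data" where
  "tensor_right C T I =
    \<lparr>ob_map = (\<lambda>X. X \<otimes>\<^bsub>T\<^esub> I), ar_map = (\<lambda>f. f \<odot>\<^bsub>T\<^esub> Ident C I)\<rparr>"

locale weak_unit = strict_tensor C T
  for C :: "('o, 'a) category" and T :: "('o, 'a) tensor"
    and I :: 'o and l r :: "'o \<Rightarrow> 'a" +
  assumes unit_in: "I \<in> Obj C"
    and left_unitor: "natural_iso C C (tensor_left C T I) id_functor l"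
    and right_unitor: "natural_iso C C (tensor_right C T I) id_functor r"
    and triangle:
      "\<lbrakk>X \<in> Obj C; Y \<in> Obj C\<rbrakk>
        \<Longrightarrow> Ident C X \<odot>\<^bsub>T\<^esub> l Y = r X \<odot>\<^bsub>T\<^esub> Ident C Y"

locale weakly_unital_monoidal = strict_tensor C T
  for C :: "('o, 'a) category" and T :: "('o, 'a) tensor" +
  assumes has_weak_unit: "\<exists>I l r. weak_unit C T I l r"


section \<open>Two-fold monoidal structures and symmetries\<close>

locale two_fold_monoidal =
  h: weakly_unital_monoidal C H + v: weakly_unital_monoidal C V
  for C :: "('o, 'a) category" and H V :: "('o, 'a) tensor" +
  assumes interchange_ob:
      "\<lbrakk>X \<in> Obj C; Y \<in> Obj C; Z \<in> Obj C; W \<in> Obj C\<rbrakk> \<Longrightarrow>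
        (X \<otimes>\<^bsub>H\<^esub> Y) \<otimes>\<^bsub>V\<^esub> (Z \<otimes>\<^bsub>H\<^esub> W) =
        (X \<otimes>\<^bsub>V\<^esub> Z) \<otimes>\<^bsub>H\<^esub> (Y \<otimes>\<^bsub>V\<^esub> W)"
    and interchange_ar:
      "\<lbrakk>f \<in> Arr C; g \<in> Arr C; h \<in> Arr C; k \<in> Arr C\<rbrakk> \<Longrightarrow>
        (f \<odot>\<^bsub>H\<^esub> g) \<odot>\<^bsub>V\<^esub> (h \<odot>\<^bsub>H\<^esub> k) =
        (f \<odot>\<^bsub>V\<^esub> h) \<odot>\<^bsub>H\<^esub> (g \<odot>\<^bsub>V\<^esub> k)"

definition opposite_tensor :: "('o, 'a) tensor \<Rightarrow> ('o, 'a) tensor" where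
  "opposite_tensor T =
    \<lparr>ob_map = (\<lambda>(X, Y). Y \<otimes>\<^bsub>T\<^esub> X), ar_map = (\<lambda>(f, g). g \<odot>\<^bsub>T\<^esub> f)\<rparr>"

locale symmetry = weakly_unital_monoidal C T
  for C :: "('o, 'a) category" and T :: "('o, 'a) tensor"
    and \<sigma> :: "'o \<times> 'o \<Rightarrow> 'a" +
  assumes natural_iso: "natural_iso (prod_category C C) C T (opposite_tensor T) \<sigma>"
    and involutive:
      "\<lbrakk>X \<in> Obj C; Y \<in> Obj C\<rbrakk>
        \<Longrightarrow> \<sigma> (Y, X) \<cdot>\<^bsub>C\<^esub> \<sigma> (X, Y) = Ident C (X \<otimes>\<^bsub>T\<^esub> Y)"
    and hexagon:
      "\<lbrakk>X \<in> Obj C; Y \<in> Obj C; Z \<in> Obj C\<rbrakk> \<Longrightarrow>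
        \<sigma> (X, Y \<otimes>\<^bsub>T\<^esub> Z) =
        (Ident C Y \<odot>\<^bsub>T\<^esub> \<sigma> (X, Z)) \<cdot>\<^bsub>C\<^esub> (\<sigma> (X, Y) \<odot>\<^bsub>T\<^esub> Ident C Z)"

end

theory Submission imports Defs begin

text \<open>
  In any double semigroup, two neighbouring interior elements of a \<open>3 \<times> 4\<close> grid commute.
  The arrows of \<open>C\<close> form a double semigroup, and by the Eckmann--Hilton argument the two
  weak units are isomorphic. Hence surrounding an object by copies of the horizontal unit
  on all four sides is a fully faithful endofunctor \<open>S\<close>, and the grid lemma makes
  \<open>S (X \<otimes> Y)\<close> and \<open>S (Y \<otimes> X)\<close> equal, on objects and on arrows. The symmetry is the
  lift of the identity of \<open>S (X \<otimes> Y)\<close> along \<open>S\<close>.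
\<close>

section \<open>Double semigroups\<close>

locale double_semigroup =
  fixes A :: "'a set"
    and hc :: "'a \<Rightarrow> 'a \<Rightarrow> 'a"  (infixr \<open>\<rhd>\<close> 70)
    and vc :: "'a \<Rightarrow> 'a \<Rightarrow> 'a"  (infixr \<open>\<nabla>\<close> 65)
  assumes hc_in [simp]: "\<lbrakk>a \<in> A; b \<in> A\<rbrakk> \<Longrightarrow> a \<rhd> b \<in> A"
    and vc_in [simp]: "\<lbrakk>a \<in> A; b \<in> A\<rbrakk> \<Longrightarrow> a \<nabla> b \<in> A"
    and hc_assoc: "\<lbrakk>a \<in> A; b \<in> A; c \<in> A\<rbrakk> \<Longrightarrow> (a \<rhd> b) \<rhd> c = a \<rhd> b \<rhd> c"
    and vc_assoc: "\<lbrakk>a \<in> A; b \<in> A; c \<in> A\<rbrakk> \<Longrightarrow> (a \<nabla> b) \<nabla> c = a \<nabla> b \<nabla> c"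
    and interchange:
      "\<lbrakk>a \<in> A; b \<in> A; c \<in> A; d \<in> A\<rbrakk> \<Longrightarrow> a \<rhd> b \<nabla> c \<rhd> d = (a \<nabla> c) \<rhd> (b \<nabla> d)"
begin

text \<open>By interchange, a horizontal dividing line can slide past another one across a
  common vertical line, and vice versa; each step below either slides a line or regroups.\<close>

lemma interior_commute:
  assumes [simp]: "a \<in> A" "b \<in> A" "c \<in> A" "d \<in> A" "e \<in> A" "f \<in> A"
    "g \<in> A" "h \<in> A" "i \<in> A" "j \<in> A" "k \<in> A" "l \<in> A"
  shows "c \<rhd> d \<rhd> e \<rhd> f \<nabla> g \<rhd> a \<rhd> b \<rhd> h \<nabla> i \<rhd> j \<rhd> k \<rhd> l =
         c \<rhd> d \<rhd> e \<rhd> f \<nabla> g \<rhd> b \<rhd> a \<rhd> h \<nabla> i \<rhd> j \<rhd> k \<rhd> l"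
proof -
  note assoc = hc_assoc vc_assoc
  have "c \<rhd> d \<rhd> e \<rhd> f \<nabla> g \<rhd> a \<rhd> b \<rhd> h \<nabla> i \<rhd> j \<rhd> k \<rhd> l =
      (c \<rhd> (d \<rhd> e \<rhd> f) \<nabla> g \<rhd> (a \<rhd> b \<rhd> h)) \<nabla> i \<rhd> j \<rhd> k \<rhd> l"
    by (simp add: assoc)
  also have "\<dots> = ((c \<nabla> g) \<rhd> (d \<rhd> e \<rhd> f \<nabla> a \<rhd> b \<rhd> h)) \<nabla> i \<rhd> (j \<rhd> k \<rhd> l)"
    by (subst interchange) simp_all
  also have "\<dots> = ((c \<nabla> g) \<nabla> i) \<rhd> ((d \<rhd> e \<rhd> f \<nabla> a \<rhd> b \<rhd> h) \<nabla> j \<rhd> k \<rhd> l)"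
    by (rule interchange) simp_all
  also have "\<dots> = ((c \<nabla> g) \<nabla> i) \<rhd> (d \<rhd> e \<rhd> f \<nabla> (a \<rhd> (b \<rhd> h) \<nabla> j \<rhd> (k \<rhd> l)))"
    by (simp add: assoc)
  also have "\<dots> = ((c \<nabla> g) \<nabla> i) \<rhd> (d \<rhd> e \<rhd> f \<nabla> ((a \<nabla> j) \<rhd> (b \<rhd> h \<nabla> k \<rhd> l)))"
    by (subst interchange[of a "b \<rhd> h" j "k \<rhd> l"]) simp_all
  also have "\<dots> = (c \<nabla> g) \<rhd> (d \<rhd> e \<rhd> f) \<nabla> i \<rhd> ((a \<nabla> j) \<rhd> (b \<rhd> h \<nabla> k \<rhd> l))"
    by (rule interchange[symmetric]) simp_all
  also have "\<dots> = (c \<nabla> g) \<rhd> (d \<rhd> e \<rhd> f) \<nabla> (i \<rhd> (a \<nabla> j)) \<rhd> (b \<rhd> h \<nabla> k \<rhd> l)"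
    by (simp add: assoc)
  also have "\<dots> = ((c \<nabla> g) \<nabla> i \<rhd> (a \<nabla> j)) \<rhd> (d \<rhd> e \<rhd> f \<nabla> b \<rhd> h \<nabla> k \<rhd> l)"
    by (rule interchange) simp_all
  also have "\<dots> = ((c \<nabla> g) \<nabla> i \<rhd> (a \<nabla> j)) \<rhd> ((d \<rhd> (e \<rhd> f) \<nabla> b \<rhd> h) \<nabla> k \<rhd> l)"
    by (simp add: assoc)
  also have "d \<rhd> (e \<rhd> f) \<nabla> b \<rhd> h = (d \<nabla> b) \<rhd> (e \<rhd> f \<nabla> h)"
    by (rule interchange) simp_all
  also have "((c \<nabla> g) \<nabla> i \<rhd> (a \<nabla> j)) \<rhd> ((d \<nabla> b) \<rhd> (e \<rhd> f \<nabla> h) \<nabla> k \<rhd> l) =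
      (c \<nabla> g) \<rhd> ((d \<nabla> b) \<rhd> (e \<rhd> f \<nabla> h)) \<nabla> (i \<rhd> (a \<nabla> j)) \<rhd> (k \<rhd> l)"
    by (rule interchange[symmetric]) simp_all
  also have "\<dots> = ((c \<nabla> g) \<rhd> (d \<nabla> b)) \<rhd> (e \<rhd> f \<nabla> h) \<nabla> (i \<rhd> (a \<nabla> j)) \<rhd> (k \<rhd> l)"
    by (simp add: assoc)
  \<comment> \<open>Now \<open>b\<close> has been absorbed into the top row, under \<open>d\<close>,
    and \<open>a\<close> into the bottom row, over \<open>j\<close>. This cut puts them one above
    the other in the left block, so that they can be pulled apart again in the exchanged
    order.\<close>
  also have "\<dots> = ((c \<nabla> g) \<rhd> (d \<nabla> b) \<nabla> i \<rhd> (a \<nabla> j)) \<rhd> ((e \<rhd> f \<nabla> h) \<nabla> k \<rhd> l)"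
    by (rule interchange) simp_all
  also have "\<dots> = ((c \<nabla> g) \<rhd> (d \<nabla> b) \<nabla> i \<rhd> (a \<nabla> j)) \<rhd> (e \<rhd> f \<nabla> (h \<nabla> k \<rhd> l))"
    by (simp add: assoc)
  also have "\<dots> = ((c \<nabla> g) \<rhd> (d \<nabla> b)) \<rhd> (e \<rhd> f) \<nabla> (i \<rhd> (a \<nabla> j)) \<rhd> (h \<nabla> k \<rhd> l)"
    by (rule interchange[symmetric]) simp_all
  also have "\<dots> = ((c \<nabla> g) \<rhd> (d \<nabla> b)) \<rhd> (e \<rhd> f) \<nabla> i \<rhd> ((a \<nabla> j) \<rhd> (h \<nabla> k \<rhd> l))"
    by (simp add: assoc)
  also have "\<dots> = ((c \<nabla> g) \<rhd> (d \<nabla> b) \<nabla> i) \<rhd> (e \<rhd> f \<nabla> ((a \<nabla> j) \<rhd> (h \<nabla> k \<rhd> l)))"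
    by (rule interchange) simp_all
  also have "(a \<nabla> j) \<rhd> (h \<nabla> k \<rhd> l) = a \<rhd> h \<nabla> j \<rhd> k \<rhd> l"
    by (rule interchange[symmetric]) simp_all
  also have "((c \<nabla> g) \<rhd> (d \<nabla> b) \<nabla> i) \<rhd> (e \<rhd> f \<nabla> (a \<rhd> h \<nabla> j \<rhd> k \<rhd> l)) =
      ((c \<nabla> g) \<rhd> (d \<nabla> b) \<nabla> i) \<rhd> ((e \<rhd> f \<nabla> a \<rhd> h) \<nabla> j \<rhd> k \<rhd> l)"
    by (simp add: assoc)
  also have "\<dots> = ((c \<nabla> g) \<rhd> (d \<nabla> b)) \<rhd> (e \<rhd> f \<nabla> a \<rhd> h) \<nabla> i \<rhd> j \<rhd> k \<rhd> l"
    by (rule interchange[symmetric]) simp_all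
  also have "\<dots> = (c \<nabla> g) \<rhd> ((d \<nabla> b) \<rhd> (e \<rhd> f \<nabla> a \<rhd> h)) \<nabla> i \<rhd> j \<rhd> k \<rhd> l"
    by (simp add: assoc)
  also have "(d \<nabla> b) \<rhd> (e \<rhd> f \<nabla> a \<rhd> h) = d \<rhd> e \<rhd> f \<nabla> b \<rhd> a \<rhd> h"
    by (rule interchange[symmetric]) simp_all
  also have "(c \<nabla> g) \<rhd> (d \<rhd> e \<rhd> f \<nabla> b \<rhd> a \<rhd> h) =
      c \<rhd> d \<rhd> e \<rhd> f \<nabla> g \<rhd> b \<rhd> a \<rhd> h"
    by (rule interchange[symmetric]) simp_all
  finally show ?thesis
    by (simp add: assoc)
qed

text \<open>The middle row has three factors against four above and below, so it fills the
  \<open>3 x 4\<close> grid exactly when \<open>a\<close> is itself a product of two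
  factors.\<close>

definition frame :: "'a \<Rightarrow> 'a \<Rightarrow> 'a" where
  "frame x a = x \<rhd> x \<rhd> x \<rhd> x \<nabla> x \<rhd> a \<rhd> x \<nabla> x \<rhd> x \<rhd> x \<rhd> x"

lemma frame_commute:
  assumes [simp]: "x \<in> A" "a \<in> A" "b \<in> A"
  shows "frame x (a \<rhd> b) = frame x (b \<rhd> a)"
  using interior_commute[of a b x x x x x x x x x x] by (simp add: frame_def hc_assoc)

text \<open>The extra factor \<open>c\<close> is absorbed into the border tile
  \<open>c \<rhd> x\<close> on the right of the middle row, so \<open>a\<close> and \<open>b\<close>
  stay an interior pair in a grid of the same shape.\<close>

lemma frame_commute_left:
  assumes [simp]: "x \<in> A" "a \<in> A" "b \<in> A" "c \<in> A"
  shows "frame x ((a \<rhd> b) \<rhd> c) = frame x ((b \<rhd> a) \<rhd> c)"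
  using interior_commute[of a b x x x x x "c \<rhd> x" x x x x] by (simp add: frame_def hc_assoc)

text \<open>After enlarging the frame on the right, \<open>b\<close> can be slid past a tile \<open>x\<close>, which
  closes the frame around \<open>a\<close>.\<close>

lemma frame_split:
  assumes [simp]: "x \<in> A" "a \<in> A" "b \<in> A"
  shows "frame x (a \<rhd> b) \<rhd> (x \<rhd> x \<rhd> x \<nabla> x \<nabla> x \<rhd> x \<rhd> x) =
         frame x a \<rhd> (x \<rhd> x \<rhd> x \<nabla> b \<rhd> x \<nabla> x \<rhd> x \<rhd> x)"
proof -
  let ?x4 = "x \<rhd> x \<rhd> x \<rhd> x"
  \<comment> \<open>Three-row blocks with matching cuts, placed side by side, merge into a single
    three-row block.\<close>
  have widen: "(?x4 \<nabla> p \<nabla> ?x4) \<rhd> (x \<rhd> x \<rhd> x \<nabla> q \<nabla> x \<rhd> x \<rhd> x) =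
      ?x4 \<rhd> x \<rhd> x \<rhd> x \<nabla> p \<rhd> q \<nabla> ?x4 \<rhd> x \<rhd> x \<rhd> x"
    if "p \<in> A" "q \<in> A" for p q
    using that by (simp add: interchange)
  show ?thesis
    \<comment> \<open>The left part of each row is taken as one tile, \<open>?x4\<close> above and
      below and \<open>x \<rhd> a\<close> in the middle; this makes \<open>b\<close> and the
      \<open>x\<close> to its right the interior pair to be exchanged.\<close>
    using widen[of "x \<rhd> (a \<rhd> b) \<rhd> x" x] widen[of "x \<rhd> a \<rhd> x" "b \<rhd> x"]
      interior_commute[of b x ?x4 x x x "x \<rhd> a" x ?x4 x x x]
    by (simp add: frame_def hc_assoc)
qed

end


section \<open>Isomorphisms and fully faithful functors\<close>

context category
begin

lemma is_isoE:
  assumes "is_iso C f"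
  obtains g where "f \<in> Arr C" "g \<in> Arr C" "Dom C g = Cod C f" "Cod C g = Dom C f"
    "g \<cdot> f = Ident C (Dom C f)" "f \<cdot> g = Ident C (Cod C f)"
  using assms unfolding is_iso_def Hom_def by blast

lemma is_isoI:
  assumes "f \<in> Arr C" "g \<in> Arr C" "Dom C g = Cod C f" "Cod C g = Dom C f"
    "g \<cdot> f = Ident C (Dom C f)" "f \<cdot> g = Ident C (Cod C f)"
  shows "is_iso C f"
  using assms unfolding is_iso_def Hom_def by blast

lemma is_iso_left_cancel:
  assumes "is_iso C t" "f \<in> Arr C" "g \<in> Arr C" "Cod C f = Dom C t" "Cod C g = Dom C t"
    and eq: "t \<cdot> f = t \<cdot> g"
  shows "f = g"
  using assms(1)
proof (rule is_isoE)
  fix s assume s: "t \<in> Arr C" "s \<in> Arr C" "Dom C s = Cod C t" "s \<cdot> t = Ident C (Dom C t)"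
  have "s \<cdot> (t \<cdot> k) = k" if "k \<in> Arr C" "Cod C k = Dom C t" for k
    using that s Comp_assoc[of k t s] Comp_Ident_left[of k] by simp
  with assms(2-5) eq show ?thesis by metis
qed

lemma is_iso_right_cancel:
  assumes "is_iso C t" "f \<in> Arr C" "g \<in> Arr C" "Dom C f = Cod C t" "Dom C g = Cod C t"
    and eq: "f \<cdot> t = g \<cdot> t"
  shows "f = g"
  using assms(1)
proof (rule is_isoE)
  fix s assume s: "t \<in> Arr C" "s \<in> Arr C" "Cod C s = Dom C t" "t \<cdot> s = Ident C (Cod C t)"
  have "(k \<cdot> t) \<cdot> s = k" if "k \<in> Arr C" "Dom C k = Cod C t" for k
    using that s Comp_assoc[of s t k] Comp_Ident_right[of k] by simp
  with assms(2-5) eq show ?thesis by metis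
qed

lemma is_iso_Comp:
  assumes f: "is_iso C f" and g: "is_iso C g" and comp: "Cod C f = Dom C g"
  shows "is_iso C (g \<cdot> f)"
proof -
  obtain f' where f': "f \<in> Arr C" "f' \<in> Arr C" "Dom C f' = Cod C f" "Cod C f' = Dom C f"
    "f' \<cdot> f = Ident C (Dom C f)" "f \<cdot> f' = Ident C (Cod C f)"
    using f by (rule is_isoE)
  obtain g' where g': "g \<in> Arr C" "g' \<in> Arr C" "Dom C g' = Cod C g" "Cod C g' = Dom C g"
    "g' \<cdot> g = Ident C (Dom C g)" "g \<cdot> g' = Ident C (Cod C g)"
    using g by (rule is_isoE)
  have "g' \<cdot> (g \<cdot> f) = f" "f \<cdot> (f' \<cdot> g') = g'"
    using f' g' comp Comp_assoc[of f g g'] Comp_Ident_left[of f]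
      Comp_assoc[of g' f' f] Comp_Ident_left[of g'] by simp_all
  then have "(f' \<cdot> g') \<cdot> (g \<cdot> f) = Ident C (Dom C f)"
    "(g \<cdot> f) \<cdot> (f' \<cdot> g') = Ident C (Cod C g)"
    using f' g' comp Comp_assoc[of "g \<cdot> f" g' f'] Comp_assoc[of "f' \<cdot> g'" f g]
    by (simp_all add: Comp_in Dom_Comp Cod_Comp)
  then show ?thesis
    using f' g' comp
    by (intro is_isoI[of _ "f' \<cdot> g'"]) (simp_all add: Comp_in Dom_Comp Cod_Comp)
qed

end

definition isomorphic :: "('o, 'a) category \<Rightarrow> 'o \<Rightarrow> 'o \<Rightarrow> bool" where
  "isomorphic C X Y \<longleftrightarrow> (\<exists>f \<in> Hom C X Y. is_iso C f)"

lemma (in category) isomorphic_sym: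
  assumes "isomorphic C X Y"
  shows "isomorphic C Y X"
proof -
  obtain f where f: "is_iso C f" "Dom C f = X" "Cod C f = Y"
    using assms by (auto simp: isomorphic_def Hom_def)
  obtain g where g: "f \<in> Arr C" "g \<in> Arr C" "Dom C g = Cod C f" "Cod C g = Dom C f"
    "g \<cdot> f = Ident C (Dom C f)" "f \<cdot> g = Ident C (Cod C f)"
    using f(1) by (rule is_isoE)
  then have "is_iso C g"
    by (intro is_isoI[of g f]) simp_all
  with f g show ?thesis
    by (auto simp: isomorphic_def Hom_def)
qed

lemma (in category) isomorphic_trans:
  assumes "isomorphic C X Y" "isomorphic C Y Z"
  shows "isomorphic C X Z"
proof -
  obtain f g where "f \<in> Hom C X Y" "is_iso C f" "g \<in> Hom C Y Z" "is_iso C g"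
    using assms unfolding isomorphic_def by blast
  then have "g \<cdot> f \<in> Hom C X Z" "is_iso C (g \<cdot> f)"
    by (auto simp: Hom_def Comp_in Dom_Comp Cod_Comp intro: is_iso_Comp)
  then show ?thesis
    unfolding isomorphic_def by blast
qed

section \<open>Closure properties of fully faithful functors\<close>

definition fully_faithful ::
    "('o, 'a) category \<Rightarrow> ('p, 'b) category \<Rightarrow> ('o, 'a, 'p, 'b) functor_data \<Rightarrow> bool" where
  "fully_faithful C D F \<longleftrightarrow> is_functor C D F \<and>
     (\<forall>X \<in> Obj C. \<forall>Y \<in> Obj C.
        bij_betw (ar_map F) (Hom C X Y) (Hom D (ob_map F X) (ob_map F Y)))"

lemma fully_faithful_id:
  assumes "category C"
  shows "fully_faithful C C id_functor"
  using assms unfolding fully_faithful_def is_functor_def is_functor_axioms_def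
  by (auto simp: id_functor_def Hom_def bij_betw_def)

definition comp_functor ::
    "('p, 'b, 'q, 'c) functor_data \<Rightarrow> ('o, 'a, 'p, 'b) functor_data \<Rightarrow>
     ('o, 'a, 'q, 'c) functor_data" where
  "comp_functor G F = \<lparr>ob_map = ob_map G \<circ> ob_map F, ar_map = ar_map G \<circ> ar_map F\<rparr>"

lemma fully_faithful_comp:
  assumes F: "fully_faithful C D F" and G: "fully_faithful D E G"
  shows "fully_faithful C E (comp_functor G F)"
proof -
  interpret F: is_functor C D F using F by (simp add: fully_faithful_def)
  interpret G: is_functor D E G using G by (simp add: fully_faithful_def)
  have "is_functor C E (comp_functor G F)"
  proof unfold_locales
    fix f assume f: "f \<in> Arr C"
    then have "ar_map F f \<in> Hom D (ob_map F (Dom C f)) (ob_map F (Cod C f))"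
      by (rule F.ar_map_in)
    then show "ar_map (comp_functor G F) f \<in>
        Hom E (ob_map (comp_functor G F) (Dom C f)) (ob_map (comp_functor G F) (Cod C f))"
      using G.ar_map_in[of "ar_map F f"] by (simp add: comp_functor_def Hom_def)
  next
    fix f g assume "f \<in> Arr C" "g \<in> Arr C" "Cod C f = Dom C g"
    then show "ar_map (comp_functor G F) (g \<cdot>\<^bsub>C\<^esub> f) =
        ar_map (comp_functor G F) g \<cdot>\<^bsub>E\<^esub> ar_map (comp_functor G F) f"
      using F.ar_map_in[of f] F.ar_map_in[of g]
      by (simp add: comp_functor_def F.ar_map_Comp G.ar_map_Comp Hom_def)
  qed (simp_all add: comp_functor_def F.ob_map_in G.ob_map_in F.ar_map_Ident G.ar_map_Ident)
  moreover have "bij_betw (ar_map (comp_functor G F)) (Hom C X Y)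
      (Hom E (ob_map (comp_functor G F) X) (ob_map (comp_functor G F) Y))"
    if "X \<in> Obj C" "Y \<in> Obj C" for X Y
    using that F G F.ob_map_in
      bij_betw_trans[of "ar_map F" "Hom C X Y" "Hom D (ob_map F X) (ob_map F Y)" "ar_map G"]
    by (simp add: fully_faithful_def comp_functor_def)
  ultimately show ?thesis
    by (simp add: fully_faithful_def)
qed

text \<open>By naturality, \<open>F\<close> and \<open>G\<close> agree on arrows up to conjugation
  by the components of \<open>\<tau>\<close>, and conjugation by isomorphisms is a bijection of
  hom-sets. Serves to pass from the identity functor to tensoring with a weak unit, and from there
  to tensoring with any object isomorphic to it.\<close>

lemma fully_faithful_natural_iso:
  assumes "natural_iso C D F G \<tau>" and G: "fully_faithful C D G"
  shows "fully_faithful C D F"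
proof -
  interpret natural_iso C D F G \<tau> by fact
  note F_in = dom_functor.ar_map_in and G_in = cod_functor.ar_map_in
  have "bij_betw (ar_map F) (Hom C X Y) (Hom D (ob_map F X) (ob_map F Y))"
    if X: "X \<in> Obj C" and Y: "Y \<in> Obj C" for X Y
    unfolding bij_betw_def
  proof (intro conjI)
    have tX: "\<tau> X \<in> Arr D" "Dom D (\<tau> X) = ob_map F X" "Cod D (\<tau> X) = ob_map G X"
      using component_in[OF X] by (auto simp: Hom_def)
    have tY: "\<tau> Y \<in> Arr D" "Dom D (\<tau> Y) = ob_map F Y" "Cod D (\<tau> Y) = ob_map G Y"
      using component_in[OF Y] by (auto simp: Hom_def)
    have bij: "bij_betw (ar_map G) (Hom C X Y) (Hom D (ob_map G X) (ob_map G Y))"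
      using G X Y by (simp add: fully_faithful_def)
    show "inj_on (ar_map F) (Hom C X Y)"
    proof (rule inj_onI)
      fix f g assume f: "f \<in> Hom C X Y" and g: "g \<in> Hom C X Y" and eq: "ar_map F f = ar_map F g"
      then have fg: "f \<in> Arr C" "Dom C f = X" "Cod C f = Y" "g \<in> Arr C" "Dom C g = X" "Cod C g = Y"
        by (simp_all add: Hom_def)
      have nat: "\<tau> Y \<cdot>\<^bsub>D\<^esub> ar_map F f = ar_map G f \<cdot>\<^bsub>D\<^esub> \<tau> X"
        "\<tau> Y \<cdot>\<^bsub>D\<^esub> ar_map F g = ar_map G g \<cdot>\<^bsub>D\<^esub> \<tau> X"
        using natural[of f] natural[of g] unfolding fg by (simp_all add: fg)
      have "ar_map G f = ar_map G g"
      proof (rule dom_functor.cod.is_iso_right_cancel[OF component_iso[OF X]])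
        show "ar_map G f \<cdot>\<^bsub>D\<^esub> \<tau> X = ar_map G g \<cdot>\<^bsub>D\<^esub> \<tau> X"
          by (simp only: nat[symmetric] eq)
      qed (use G_in[of f] G_in[of g] in \<open>simp_all add: fg tX Hom_def\<close>)
      with f g show "f = g"
        using bij by (meson bij_betw_def inj_onD)
    qed
    show "ar_map F ` Hom C X Y = Hom D (ob_map F X) (ob_map F Y)"
    proof
      show "ar_map F ` Hom C X Y \<subseteq> Hom D (ob_map F X) (ob_map F Y)"
        using F_in by (auto simp: Hom_def)
      show "Hom D (ob_map F X) (ob_map F Y) \<subseteq> ar_map F ` Hom C X Y"
      proof
        fix k assume "k \<in> Hom D (ob_map F X) (ob_map F Y)"
        then have k: "k \<in> Arr D" "Dom D k = ob_map F X" "Cod D k = ob_map F Y"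
          by (auto simp: Hom_def)
        obtain s where s: "s \<in> Arr D" "Dom D s = ob_map G X" "Cod D s = ob_map F X"
          "s \<cdot>\<^bsub>D\<^esub> \<tau> X = Ident D (ob_map F X)"
          using component_iso[OF X] tX by (auto elim: dom_functor.cod.is_isoE)
        \<comment> \<open>The conjugate of \<open>k\<close> by \<open>\<tau>\<close>; a preimage of
          it under \<open>G\<close> is the arrow that \<open>F\<close> sends to
          \<open>k\<close>.\<close>
        let ?m = "(\<tau> Y \<cdot>\<^bsub>D\<^esub> k) \<cdot>\<^bsub>D\<^esub> s"
        have tk: "\<tau> Y \<cdot>\<^bsub>D\<^esub> k \<in> Arr D" "Dom D (\<tau> Y \<cdot>\<^bsub>D\<^esub> k) = ob_map F X"
          "Cod D (\<tau> Y \<cdot>\<^bsub>D\<^esub> k) = ob_map G Y"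
          using k tY
          by (simp_all add: dom_functor.cod.Comp_in dom_functor.cod.Dom_Comp
              dom_functor.cod.Cod_Comp)
        then have "?m \<in> Hom D (ob_map G X) (ob_map G Y)"
          using s by (simp add: Hom_def dom_functor.cod.Comp_in dom_functor.cod.Dom_Comp
              dom_functor.cod.Cod_Comp)
        then obtain f where f: "f \<in> Hom C X Y" "ar_map G f = ?m"
          using bij by (metis bij_betw_def imageE)
        then have f': "f \<in> Arr C" "Dom C f = X" "Cod C f = Y"
          by (simp_all add: Hom_def)
        have "\<tau> Y \<cdot>\<^bsub>D\<^esub> ar_map F f = ?m \<cdot>\<^bsub>D\<^esub> \<tau> X"
          using natural[of f] f(2) by (simp only: f')
        also have "\<dots> = (\<tau> Y \<cdot>\<^bsub>D\<^esub> k) \<cdot>\<^bsub>D\<^esub> (s \<cdot>\<^bsub>D\<^esub> \<tau> X)"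
          using dom_functor.cod.Comp_assoc[of "\<tau> X" s "\<tau> Y \<cdot>\<^bsub>D\<^esub> k"] s tX tk by simp
        also have "\<dots> = \<tau> Y \<cdot>\<^bsub>D\<^esub> k"
          using dom_functor.cod.Comp_Ident_right[OF tk(1)] by (simp only: s tk)
        finally have eq: "\<tau> Y \<cdot>\<^bsub>D\<^esub> ar_map F f = \<tau> Y \<cdot>\<^bsub>D\<^esub> k" .
        have "ar_map F f = k"
          by (rule dom_functor.cod.is_iso_left_cancel[OF component_iso[OF Y] _ _ _ _ eq])
            (use F_in[of f] in \<open>simp_all add: f' k tY Hom_def\<close>)
        with f show "k \<in> ar_map F ` Hom C X Y" by blast
      qed
    qed
  qed
  then show ?thesis
    using dom_functor.is_functor_axioms by (simp add: fully_faithful_def)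
qed


section \<open>Objects isomorphic to a unit\<close>

context strict_tensor
begin

lemma tensor_ob_in: "\<lbrakk>X \<in> Obj C; Y \<in> Obj C\<rbrakk> \<Longrightarrow> X \<otimes>\<^bsub>T\<^esub> Y \<in> Obj C"
  using ob_map_in[of "(X, Y)"] by (simp add: prod_category_def)

lemma tensor_ar:
  assumes "f \<in> Arr C" "g \<in> Arr C"
  shows tensor_ar_in: "f \<odot>\<^bsub>T\<^esub> g \<in> Arr C"
    and Dom_tensor: "Dom C (f \<odot>\<^bsub>T\<^esub> g) = Dom C f \<otimes>\<^bsub>T\<^esub> Dom C g"
    and Cod_tensor: "Cod C (f \<odot>\<^bsub>T\<^esub> g) = Cod C f \<otimes>\<^bsub>T\<^esub> Cod C g"
  using ar_map_in[of "(f, g)"] assms by (simp_all add: prod_category_def Hom_def)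

lemma tensor_Ident:
  "\<lbrakk>X \<in> Obj C; Y \<in> Obj C\<rbrakk> \<Longrightarrow> Ident C X \<odot>\<^bsub>T\<^esub> Ident C Y = Ident C (X \<otimes>\<^bsub>T\<^esub> Y)"
  using ar_map_Ident[of "(X, Y)"] by (simp add: prod_category_def)

lemma tensor_Comp:
  "\<lbrakk>f \<in> Arr C; g \<in> Arr C; Cod C f = Dom C g; f' \<in> Arr C; g' \<in> Arr C; Cod C f' = Dom C g'\<rbrakk>
    \<Longrightarrow> (g \<cdot>\<^bsub>C\<^esub> f) \<odot>\<^bsub>T\<^esub> (g' \<cdot>\<^bsub>C\<^esub> f') = (g \<odot>\<^bsub>T\<^esub> g') \<cdot>\<^bsub>C\<^esub> (f \<odot>\<^bsub>T\<^esub> f')"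
  using ar_map_Comp[of "(f, f')" "(g, g')"] by (simp add: prod_category_def)

lemmas tensor_simps = tensor_ob_in tensor_ar tensor_Ident
  cod.Ident_in cod.Dom_Ident cod.Cod_Ident

lemma is_iso_tensor:
  assumes f: "is_iso C f" and g: "is_iso C g"
  shows "is_iso C (f \<odot>\<^bsub>T\<^esub> g)"
proof -
  obtain f' where f': "f \<in> Arr C" "f' \<in> Arr C" "Dom C f' = Cod C f" "Cod C f' = Dom C f"
    "f' \<cdot>\<^bsub>C\<^esub> f = Ident C (Dom C f)" "f \<cdot>\<^bsub>C\<^esub> f' = Ident C (Cod C f)"
    using f by (rule cod.is_isoE)
  obtain g' where g': "g \<in> Arr C" "g' \<in> Arr C" "Dom C g' = Cod C g" "Cod C g' = Dom C g"
    "g' \<cdot>\<^bsub>C\<^esub> g = Ident C (Dom C g)" "g \<cdot>\<^bsub>C\<^esub> g' = Ident C (Cod C g)"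
    using g by (rule cod.is_isoE)
  show ?thesis
    using f' g'
    by (intro cod.is_isoI[of _ "f' \<odot>\<^bsub>T\<^esub> g'"])
      (simp_all add: tensor_simps tensor_Comp[symmetric] cod.Dom_in cod.Cod_in)
qed

lemma is_iso_Ident: "X \<in> Obj C \<Longrightarrow> is_iso C (Ident C X)"
  using cod.Comp_Ident_left[of "Ident C X"]
  by (intro cod.is_isoI[of _ "Ident C X"]) (simp_all add: tensor_simps)

lemma isomorphic_tensor:
  assumes "isomorphic C X X'" "isomorphic C Y Y'"
  shows "isomorphic C (X \<otimes>\<^bsub>T\<^esub> Y) (X' \<otimes>\<^bsub>T\<^esub> Y')"
proof -
  obtain f g where "f \<in> Hom C X X'" "is_iso C f" "g \<in> Hom C Y Y'" "is_iso C g"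
    using assms unfolding isomorphic_def by blast
  then have "f \<odot>\<^bsub>T\<^esub> g \<in> Hom C (X \<otimes>\<^bsub>T\<^esub> Y) (X' \<otimes>\<^bsub>T\<^esub> Y')" "is_iso C (f \<odot>\<^bsub>T\<^esub> g)"
    by (auto simp: Hom_def tensor_ar is_iso_tensor)
  then show ?thesis
    unfolding isomorphic_def by blast
qed

lemma is_functor_tensor_left:
  assumes "U \<in> Obj C"
  shows "is_functor C C (tensor_left C T U)"
proof unfold_locales
  fix f g assume "f \<in> Arr C" "g \<in> Arr C" "Cod C f = Dom C g"
  then show "ar_map (tensor_left C T U) (g \<cdot>\<^bsub>C\<^esub> f) =
      ar_map (tensor_left C T U) g \<cdot>\<^bsub>C\<^esub> ar_map (tensor_left C T U) f"
    using tensor_Comp[of "Ident C U" "Ident C U" f g] cod.Comp_Ident_left[of "Ident C U"] assms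
    by (simp add: tensor_left_def tensor_simps)
qed (use assms in \<open>simp_all add: tensor_left_def tensor_simps Hom_def\<close>)

lemma is_functor_tensor_right:
  assumes "U \<in> Obj C"
  shows "is_functor C C (tensor_right C T U)"
proof unfold_locales
  fix f g assume "f \<in> Arr C" "g \<in> Arr C" "Cod C f = Dom C g"
  then show "ar_map (tensor_right C T U) (g \<cdot>\<^bsub>C\<^esub> f) =
      ar_map (tensor_right C T U) g \<cdot>\<^bsub>C\<^esub> ar_map (tensor_right C T U) f"
    using tensor_Comp[of f g "Ident C U" "Ident C U"] cod.Comp_Ident_left[of "Ident C U"] assms
    by (simp add: tensor_right_def tensor_simps)
qed (use assms in \<open>simp_all add: tensor_right_def tensor_simps Hom_def\<close>)

end

section \<open>Tensoring with an object isomorphic to the weak unit\<close>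

context weak_unit
begin

text \<open>Tensoring \<open>u : U \<rightarrow> I\<close> with identities gives a natural
  isomorphism to tensoring with \<open>I\<close>, which the left unitor compares with the identity
  functor.\<close>

lemma fully_faithful_tensor_left:
  assumes U: "U \<in> Obj C" and iso: "isomorphic C U I"
  shows "fully_faithful C C (tensor_left C T U)"
proof -
  obtain u where u: "u \<in> Arr C" "Dom C u = U" "Cod C u = I" "is_iso C u"
    using iso by (auto simp: isomorphic_def Hom_def)
  have "natural_iso C C (tensor_left C T U) (tensor_left C T I) (\<lambda>X. u \<odot>\<^bsub>T\<^esub> Ident C X)"
  proof (intro natural_iso.intro is_functor_tensor_left U unit_in natural_iso_axioms.intro)
    fix f assume f: "f \<in> Arr C"
    \<comment> \<open>By functoriality of the tensor, both paths around the naturality square equal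
      \<open>u\<close> tensored with \<open>f\<close>.\<close>
    have "(u \<odot>\<^bsub>T\<^esub> Ident C (Cod C f)) \<cdot>\<^bsub>C\<^esub> (Ident C U \<odot>\<^bsub>T\<^esub> f) = u \<odot>\<^bsub>T\<^esub> f"
      using tensor_Comp[of "Ident C U" u f "Ident C (Cod C f)"] u f U cod.Comp_Ident_right[OF u(1)]
      by (simp add: tensor_simps cod.Cod_in cod.Comp_Ident_left)
    moreover have "(Ident C I \<odot>\<^bsub>T\<^esub> f) \<cdot>\<^bsub>C\<^esub> (u \<odot>\<^bsub>T\<^esub> Ident C (Dom C f)) = u \<odot>\<^bsub>T\<^esub> f"
      using tensor_Comp[of u "Ident C I" "Ident C (Dom C f)" f] u f unit_in
        cod.Comp_Ident_left[OF u(1)]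
      by (simp add: tensor_simps cod.Dom_in cod.Comp_Ident_right)
    ultimately show "(u \<odot>\<^bsub>T\<^esub> Ident C (Cod C f)) \<cdot>\<^bsub>C\<^esub> ar_map (tensor_left C T U) f =
        ar_map (tensor_left C T I) f \<cdot>\<^bsub>C\<^esub> (u \<odot>\<^bsub>T\<^esub> Ident C (Dom C f))"
      by (simp add: tensor_left_def)
  qed (use u in \<open>simp_all add: tensor_left_def tensor_simps Hom_def is_iso_tensor is_iso_Ident\<close>)
  moreover have "fully_faithful C C (tensor_left C T I)"
    using left_unitor fully_faithful_id[OF cod.category_axioms] by (rule fully_faithful_natural_iso)
  ultimately show ?thesis
    by (rule fully_faithful_natural_iso)
qed

lemma fully_faithful_tensor_right:
  assumes U: "U \<in> Obj C" and iso: "isomorphic C U I"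
  shows "fully_faithful C C (tensor_right C T U)"
proof -
  obtain u where u: "u \<in> Arr C" "Dom C u = U" "Cod C u = I" "is_iso C u"
    using iso by (auto simp: isomorphic_def Hom_def)
  have "natural_iso C C (tensor_right C T U) (tensor_right C T I) (\<lambda>X. Ident C X \<odot>\<^bsub>T\<^esub> u)"
  proof (intro natural_iso.intro is_functor_tensor_right U unit_in natural_iso_axioms.intro)
    fix f assume f: "f \<in> Arr C"
    have "(Ident C (Cod C f) \<odot>\<^bsub>T\<^esub> u) \<cdot>\<^bsub>C\<^esub> (f \<odot>\<^bsub>T\<^esub> Ident C U) = f \<odot>\<^bsub>T\<^esub> u"
      using tensor_Comp[of f "Ident C (Cod C f)" "Ident C U" u] u f U cod.Comp_Ident_right[OF u(1)]
      by (simp add: tensor_simps cod.Cod_in cod.Comp_Ident_left)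
    moreover have "(f \<odot>\<^bsub>T\<^esub> Ident C I) \<cdot>\<^bsub>C\<^esub> (Ident C (Dom C f) \<odot>\<^bsub>T\<^esub> u) = f \<odot>\<^bsub>T\<^esub> u"
      using tensor_Comp[of "Ident C (Dom C f)" f u "Ident C I"] u f unit_in
        cod.Comp_Ident_left[OF u(1)]
      by (simp add: tensor_simps cod.Dom_in cod.Comp_Ident_right)
    ultimately show "(Ident C (Cod C f) \<odot>\<^bsub>T\<^esub> u) \<cdot>\<^bsub>C\<^esub> ar_map (tensor_right C T U) f =
        ar_map (tensor_right C T I) f \<cdot>\<^bsub>C\<^esub> (Ident C (Dom C f) \<odot>\<^bsub>T\<^esub> u)"
      by (simp add: tensor_right_def)
  qed (use u in \<open>simp_all add: tensor_right_def tensor_simps Hom_def is_iso_tensor is_iso_Ident\<close>)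
  moreover have "fully_faithful C C (tensor_right C T I)"
    using right_unitor fully_faithful_id[OF cod.category_axioms]
    by (rule fully_faithful_natural_iso)
  ultimately show ?thesis
    by (rule fully_faithful_natural_iso)
qed

lemma isomorphic_tensor_unit:
  assumes "X \<in> Obj C"
  shows "isomorphic C (I \<otimes>\<^bsub>T\<^esub> X) X" "isomorphic C (X \<otimes>\<^bsub>T\<^esub> I) X"
proof -
  interpret l: natural_iso C C "tensor_left C T I" id_functor l by (rule left_unitor)
  interpret r: natural_iso C C "tensor_right C T I" id_functor r by (rule right_unitor)
  show "isomorphic C (I \<otimes>\<^bsub>T\<^esub> X) X" "isomorphic C (X \<otimes>\<^bsub>T\<^esub> I) X"
    using assms l.component_in[of X] l.component_iso[of X] r.component_in[of X]
      r.component_iso[of X]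
    by (auto simp: isomorphic_def tensor_left_def tensor_right_def id_functor_def)
qed

end


section \<open>Symmetries induced by a commutative fully faithful functor\<close>

lemma (in strict_tensor) is_functor_opposite_tensor:
  "is_functor (prod_category C C) C (opposite_tensor T)"
proof unfold_locales
  fix f g assume f: "f \<in> Arr (prod_category C C)" and g: "g \<in> Arr (prod_category C C)"
    and "Cod (prod_category C C) f = Dom (prod_category C C) g"
  then show "ar_map (opposite_tensor T) (g \<cdot>\<^bsub>prod_category C C\<^esub> f) =
      ar_map (opposite_tensor T) g \<cdot>\<^bsub>C\<^esub> ar_map (opposite_tensor T) f"
    by (cases f; cases g) (auto simp: opposite_tensor_def prod_category_def tensor_Comp)
qed (auto simp: opposite_tensor_def prod_category_def tensor_simps Hom_def)

text \<open>The symmetry at \<open>X\<close>, \<open>Y\<close> is the unique arrow sent by \<open>S\<close> to an identity; this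
  makes its diagonal trivial, and reduces each axiom to uniqueness.\<close>

lemma (in weakly_unital_monoidal) symmetry_of_fully_faithful:
  assumes S: "fully_faithful C C S"
    and comm: "\<And>f g. \<lbrakk>f \<in> Arr C; g \<in> Arr C\<rbrakk> \<Longrightarrow> ar_map S (f \<odot>\<^bsub>T\<^esub> g) = ar_map S (g \<odot>\<^bsub>T\<^esub> f)"
    and comm_left: "\<And>f g k. \<lbrakk>f \<in> Arr C; g \<in> Arr C; k \<in> Arr C\<rbrakk> \<Longrightarrow>
        ar_map S ((f \<odot>\<^bsub>T\<^esub> g) \<odot>\<^bsub>T\<^esub> k) = ar_map S ((g \<odot>\<^bsub>T\<^esub> f) \<odot>\<^bsub>T\<^esub> k)"
    and stable: "\<And>f Z. \<lbrakk>f \<in> Arr C; Z \<in> Obj C; ar_map S f = Ident C (ob_map S (Dom C f));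
        ob_map S (Dom C f \<otimes>\<^bsub>T\<^esub> Z) = ob_map S (Cod C f \<otimes>\<^bsub>T\<^esub> Z)\<rbrakk> \<Longrightarrow>
        ar_map S (f \<odot>\<^bsub>T\<^esub> Ident C Z) = Ident C (ob_map S (Dom C f \<otimes>\<^bsub>T\<^esub> Z))"
  shows "\<exists>\<sigma>. symmetry C T \<sigma> \<and> (\<forall>X \<in> Obj C. \<sigma> (X, X) = Ident C (X \<otimes>\<^bsub>T\<^esub> X))"
proof -
  interpret S: is_functor C C S
    using S by (simp add: fully_faithful_def)
  have S_ar: "ar_map S f \<in> Arr C" "Dom C (ar_map S f) = ob_map S (Dom C f)"
    "Cod C (ar_map S f) = ob_map S (Cod C f)" if "f \<in> Arr C" for f
    using S.ar_map_in[OF that] by (simp_all add: Hom_def)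
  have faithful: "f = g"
    if "ar_map S f = ar_map S g" "f \<in> Arr C" "g \<in> Arr C" "Dom C f = Dom C g" "Cod C f = Cod C g"
    for f g
  proof -
    have "inj_on (ar_map S) (Hom C (Dom C g) (Cod C g))"
      using S that cod.Dom_in cod.Cod_in by (simp add: fully_faithful_def bij_betw_def)
    then show ?thesis
      using that by (simp add: inj_on_def Hom_def)
  qed
  \<comment> \<open>Equations between objects are read off from those between arrows by taking
    domains at identities.\<close>
  have ob_comm: "ob_map S (X \<otimes>\<^bsub>T\<^esub> Y) = ob_map S (Y \<otimes>\<^bsub>T\<^esub> X)" if "X \<in> Obj C" "Y \<in> Obj C" for X Y
    using arg_cong[OF comm[of "Ident C X" "Ident C Y"], of "Dom C"] that
    by (simp add: S_ar tensor_simps)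
  have ob_comm_left: "ob_map S ((X \<otimes>\<^bsub>T\<^esub> Y) \<otimes>\<^bsub>T\<^esub> Z) = ob_map S ((Y \<otimes>\<^bsub>T\<^esub> X) \<otimes>\<^bsub>T\<^esub> Z)"
    if "X \<in> Obj C" "Y \<in> Obj C" "Z \<in> Obj C" for X Y Z
    using arg_cong[OF comm_left[of "Ident C X" "Ident C Y" "Ident C Z"], of "Dom C"] that
    by (simp add: S_ar tensor_simps)

  \<comment> \<open>The arrows that \<open>S\<close> sends to identities. By faithfulness there is
    at most one between two given objects, and \<open>S\<close> does not see composition with
    them.\<close>
  define null where "null f \<longleftrightarrow> f \<in> Arr C \<and> ar_map S f = Ident C (ob_map S (Dom C f))" for f
  have null_unique: "f = g" if "null f" "null g" "Dom C f = Dom C g" "Cod C f = Cod C g" for f g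
    by (rule faithful) (use that in \<open>simp_all add: null_def\<close>)
  have null_Ident: "null (Ident C X)" if "X \<in> Obj C" for X
    using that by (simp add: null_def tensor_simps S.ar_map_Ident)
  have null_ob: "ob_map S (Dom C f) = ob_map S (Cod C f)" if "null f" for f
    using that S_ar(3)[of f] by (simp add: null_def cod.Dom_in cod.Cod_Ident S.ob_map_in)
  have S_Comp_null_left: "ar_map S (t \<cdot>\<^bsub>C\<^esub> f) = ar_map S f"
    if "null t" "f \<in> Arr C" "Cod C f = Dom C t" for t f
    using that cod.Comp_Ident_left[of "ar_map S f"] by (simp add: null_def S.ar_map_Comp S_ar)
  have S_Comp_null_right: "ar_map S (f \<cdot>\<^bsub>C\<^esub> t) = ar_map S f"
    if "null t" "f \<in> Arr C" "Cod C t = Dom C f" for t f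
  proof -
    \<comment> \<open>The definition of \<open>null\<close> names the identity at the domain of
      \<open>t\<close>; \<open>null_ob\<close> transports it to the codomain, where \<open>f\<close>
      starts.\<close>
    have "ar_map S t = Ident C (ob_map S (Dom C f))"
      using that null_ob[of t] by (metis null_def)
    then show ?thesis
      using that cod.Comp_Ident_right[of "ar_map S f"] by (simp add: null_def S.ar_map_Comp S_ar)
  qed
  have null_Comp: "null (g \<cdot>\<^bsub>C\<^esub> f)" if "null f" "null g" "Cod C f = Dom C g" for f g
    using that S_Comp_null_left[of g f] by (simp add: null_def cod.Comp_in cod.Dom_Comp)

  \<comment> \<open>Since \<open>S\<close> takes equal values at the two objects, the identity there
    is also an arrow from the image of the first to the image of the second, and fullness lifts
    it.\<close>
  have "\<exists>f. f \<in> Hom C (X \<otimes>\<^bsub>T\<^esub> Y) (Y \<otimes>\<^bsub>T\<^esub> X) \<and> null f" if X: "X \<in> Obj C" and Y: "Y \<in> Obj C" for X Y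
  proof -
    have "Ident C (ob_map S (X \<otimes>\<^bsub>T\<^esub> Y)) \<in> Hom C (ob_map S (X \<otimes>\<^bsub>T\<^esub> Y)) (ob_map S (Y \<otimes>\<^bsub>T\<^esub> X))"
      using X Y ob_comm[OF X Y, symmetric] by (simp add: Hom_def S.ob_map_in tensor_simps)
    moreover have "ar_map S ` Hom C (X \<otimes>\<^bsub>T\<^esub> Y) (Y \<otimes>\<^bsub>T\<^esub> X) =
        Hom C (ob_map S (X \<otimes>\<^bsub>T\<^esub> Y)) (ob_map S (Y \<otimes>\<^bsub>T\<^esub> X))"
      using S X Y by (simp add: fully_faithful_def bij_betw_def tensor_ob_in)
    ultimately obtain f where "f \<in> Hom C (X \<otimes>\<^bsub>T\<^esub> Y) (Y \<otimes>\<^bsub>T\<^esub> X)"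
      "ar_map S f = Ident C (ob_map S (X \<otimes>\<^bsub>T\<^esub> Y))"
      by (metis imageE)
    then show ?thesis
      by (auto simp: null_def Hom_def)
  qed
  then obtain \<tau> where \<tau>: "\<tau> X Y \<in> Hom C (X \<otimes>\<^bsub>T\<^esub> Y) (Y \<otimes>\<^bsub>T\<^esub> X) \<and> null (\<tau> X Y)"
    if "X \<in> Obj C" "Y \<in> Obj C" for X Y
    by metis
  define \<sigma> where "\<sigma> = (\<lambda>(X, Y). \<tau> X Y)"
  have \<sigma>: "\<sigma> (X, Y) \<in> Arr C" "Dom C (\<sigma> (X, Y)) = X \<otimes>\<^bsub>T\<^esub> Y" "Cod C (\<sigma> (X, Y)) = Y \<otimes>\<^bsub>T\<^esub> X"
    "null (\<sigma> (X, Y))" if "X \<in> Obj C" "Y \<in> Obj C" for X Y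
    using \<tau>[OF that] by (simp_all add: \<sigma>_def Hom_def)
  note \<sigma>_simps = \<sigma> tensor_simps cod.Comp_in cod.Dom_Comp cod.Cod_Comp

  have inv: "\<sigma> (Y, X) \<cdot>\<^bsub>C\<^esub> \<sigma> (X, Y) = Ident C (X \<otimes>\<^bsub>T\<^esub> Y)" if "X \<in> Obj C" "Y \<in> Obj C" for X Y
    using that by (intro null_unique null_Comp null_Ident) (simp_all add: \<sigma>_simps)
  \<comment> \<open>Under \<open>S\<close> the null factors disappear, and what remains is the
    commutation hypothesis \<open>comm\<close>.\<close>
  have nat: "\<sigma> (Cod C f, Cod C g) \<cdot>\<^bsub>C\<^esub> (f \<odot>\<^bsub>T\<^esub> g) = (g \<odot>\<^bsub>T\<^esub> f) \<cdot>\<^bsub>C\<^esub> \<sigma> (Dom C f, Dom C g)"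
    if "f \<in> Arr C" "g \<in> Arr C" for f g
    by (rule faithful)
      (use that in \<open>simp_all add: \<sigma>_simps cod.Dom_in cod.Cod_in S_Comp_null_left
        S_Comp_null_right comm[of f g]\<close>)
  have hex: "\<sigma> (X, Y \<otimes>\<^bsub>T\<^esub> Z) =
      (Ident C Y \<odot>\<^bsub>T\<^esub> \<sigma> (X, Z)) \<cdot>\<^bsub>C\<^esub> (\<sigma> (X, Y) \<odot>\<^bsub>T\<^esub> Ident C Z)"
    if X: "X \<in> Obj C" and Y: "Y \<in> Obj C" and Z: "Z \<in> Obj C" for X Y Z
  proof (intro null_unique null_Comp)
    \<comment> \<open>This is where \<open>stable\<close> enters; its condition on objects is
      supplied by \<open>ob_comm_left\<close>.\<close>
    have right: "null (\<sigma> (X, Y) \<odot>\<^bsub>T\<^esub> Ident C Z)" if "X \<in> Obj C" "Y \<in> Obj C" "Z \<in> Obj C" for X Y Z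
      using that \<sigma>(4)[OF that(1,2)] stable[of "\<sigma> (X, Y)" Z] ob_comm_left[OF that]
      by (simp add: null_def \<sigma>_simps(1-3) tensor_simps)
    then show "null (\<sigma> (X, Y) \<odot>\<^bsub>T\<^esub> Ident C Z)"
      using X Y Z by blast
    \<comment> \<open>Under \<open>S\<close>, \<open>comm\<close> exchanges the identity with the
      symmetry, which reduces tensoring on the left to \<open>right\<close>.\<close>
    show "null (Ident C Y \<odot>\<^bsub>T\<^esub> \<sigma> (X, Z))"
      using right[OF X Z Y] comm[of "Ident C Y" "\<sigma> (X, Z)"] ob_comm[of Y "X \<otimes>\<^bsub>T\<^esub> Z"] X Y Z
      by (simp add: null_def \<sigma>_simps(1-3) tensor_simps)
  qed (use X Y Z in \<open>simp_all add: \<sigma>_simps assoc_ob\<close>)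
  have diag: "\<sigma> (X, X) = Ident C (X \<otimes>\<^bsub>T\<^esub> X)" if "X \<in> Obj C" for X
    using that by (intro null_unique null_Ident) (simp_all add: \<sigma>_simps)

  have iso: "is_iso C (\<sigma> (X, Y))" if "X \<in> Obj C" "Y \<in> Obj C" for X Y
    using that inv by (intro cod.is_isoI[of _ "\<sigma> (Y, X)"]) (simp_all add: \<sigma>_simps)
  have "natural_iso (prod_category C C) C T (opposite_tensor T) \<sigma>"
  proof (intro natural_iso.intro is_functor_axioms is_functor_opposite_tensor
      natural_iso_axioms.intro)
    fix p assume "p \<in> Obj (prod_category C C)"
    then show "\<sigma> p \<in> Hom C (ob_map T p) (ob_map (opposite_tensor T) p)" "is_iso C (\<sigma> p)"
      using iso by (auto simp: prod_category_def opposite_tensor_def Hom_def \<sigma>)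
  next
    fix p assume "p \<in> Arr (prod_category C C)"
    then show "\<sigma> (Cod (prod_category C C) p) \<cdot>\<^bsub>C\<^esub> ar_map T p =
        ar_map (opposite_tensor T) p \<cdot>\<^bsub>C\<^esub> \<sigma> (Dom (prod_category C C) p)"
      using nat by (auto simp: prod_category_def opposite_tensor_def)
  qed
  then have "symmetry C T \<sigma>"
    using inv hex by (intro symmetry.intro weakly_unital_monoidal_axioms symmetry_axioms.intro)
  with diag show ?thesis by blast
qed

section \<open>The framing functor of a two-fold monoidal category\<close>

context two_fold_monoidal
begin

sublocale arrows: double_semigroup "Arr C" "\<lambda>f g. f \<odot>\<^bsub>H\<^esub> g" "\<lambda>f g. f \<odot>\<^bsub>V\<^esub> g"
  by unfold_locales
    (simp_all add: h.tensor_ar v.tensor_ar h.assoc_ar v.assoc_ar interchange_ar)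

text \<open>Interchange equates \<open>(I \<otimes>\<^sub>H J) \<otimes>\<^sub>V (J
  \<otimes>\<^sub>H I)\<close> with \<open>(I \<otimes>\<^sub>V J) \<otimes>\<^sub>H (J
  \<otimes>\<^sub>V I)\<close>. The unitors collapse the first to \<open>J\<close> and the second to
  \<open>I\<close>.\<close>

lemma units_isomorphic:
  assumes h: "weak_unit C H I l r" and v: "weak_unit C V J l' r'"
  shows "isomorphic C I J"
proof -
  interpret wh: weak_unit C H I l r by fact
  interpret wv: weak_unit C V J l' r' by fact
  note I = wh.unit_in and J = wv.unit_in
  note sym = h.cod.isomorphic_sym and trans = h.cod.isomorphic_trans
  have "isomorphic C ((I \<otimes>\<^bsub>H\<^esub> J) \<otimes>\<^bsub>V\<^esub> (J \<otimes>\<^bsub>H\<^esub> I)) (J \<otimes>\<^bsub>V\<^esub> J)"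
    by (intro v.isomorphic_tensor wh.isomorphic_tensor_unit J)
  then have J': "isomorphic C ((I \<otimes>\<^bsub>H\<^esub> J) \<otimes>\<^bsub>V\<^esub> (J \<otimes>\<^bsub>H\<^esub> I)) J"
    using wv.isomorphic_tensor_unit(1)[OF J] by (rule trans)
  have "isomorphic C ((I \<otimes>\<^bsub>V\<^esub> J) \<otimes>\<^bsub>H\<^esub> (J \<otimes>\<^bsub>V\<^esub> I)) (I \<otimes>\<^bsub>H\<^esub> I)"
    by (intro h.isomorphic_tensor wv.isomorphic_tensor_unit I)
  then have "isomorphic C ((I \<otimes>\<^bsub>V\<^esub> J) \<otimes>\<^bsub>H\<^esub> (J \<otimes>\<^bsub>V\<^esub> I)) I"
    using wh.isomorphic_tensor_unit(1)[OF I] by (rule trans)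
  then show ?thesis
    using J' interchange_ob[OF I J J I] by (metis sym trans)
qed

text \<open>\<open>symmetry_of_fully_faithful\<close> is applied to framing by the horizontal unit.
  Both commutation hypotheses are grid lemmas; stability comes from \<open>frame_split\<close> by
  cancelling a factor isomorphic to the unit.\<close>

lemma degenerate_symmetric:
  "\<exists>\<sigma>. symmetry C H \<sigma> \<and> (\<forall>X \<in> Obj C. \<sigma> (X, X) = Ident C (X \<otimes>\<^bsub>H\<^esub> X))"
proof -
  obtain I l r where h: "weak_unit C H I l r"
    using h.has_weak_unit by blast
  obtain J l' r' where v: "weak_unit C V J l' r'"
    using v.has_weak_unit by blast
  interpret wh: weak_unit C H I l r by fact
  interpret wv: weak_unit C V J l' r' by fact
  note I = wh.unit_in and J = wv.unit_in
  note sym = h.cod.isomorphic_sym and trans = h.cod.isomorphic_trans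
  have IJ: "isomorphic C I J"
    using h v by (rule units_isomorphic)

  \<comment> \<open>These objects are isomorphic to both units, and closed under both tensors; hence
    tensoring with any of them, on either side and in either direction, is fully faithful.\<close>
  define unital where "unital U \<longleftrightarrow> U \<in> Obj C \<and> isomorphic C U I" for U
  \<comment> \<open>An isomorphism from \<open>I\<close> to itself is obtained by going to
    \<open>J\<close> and back.\<close>
  have unital_I: "unital I"
    using I IJ by (metis unital_def sym trans)
  have unital_h: "unital (U \<otimes>\<^bsub>H\<^esub> W)" if "unital U" "unital W" for U W
    using that h.isomorphic_tensor[of U I W I] wh.isomorphic_tensor_unit(1)[OF I]
    by (metis unital_def trans h.tensor_ob_in)
  have unital_J: "isomorphic C U J" if "unital U" for U
    using that IJ by (metis unital_def trans)
  have unital_v: "unital (U \<otimes>\<^bsub>V\<^esub> W)" if "unital U" "unital W" for U W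
  proof -
    have "isomorphic C (U \<otimes>\<^bsub>V\<^esub> W) (J \<otimes>\<^bsub>V\<^esub> J)"
      using that by (intro v.isomorphic_tensor unital_J)
    then have "isomorphic C (U \<otimes>\<^bsub>V\<^esub> W) I"
      using wv.isomorphic_tensor_unit(1)[OF J] sym[OF IJ] trans by blast
    then show ?thesis
      using that by (simp add: unital_def v.tensor_ob_in)
  qed
  have ff_h: "fully_faithful C C (tensor_left C H U)" "fully_faithful C C (tensor_right C H U)"
    if "unital U" for U
    using that wh.fully_faithful_tensor_left wh.fully_faithful_tensor_right
    by (simp_all add: unital_def)
  have ff_v: "fully_faithful C C (tensor_left C V U)" "fully_faithful C C (tensor_right C V U)"
    if "unital U" for U
    using that unital_J wv.fully_faithful_tensor_left wv.fully_faithful_tensor_right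
    by (simp_all add: unital_def)

  define x where "x = Ident C I"
  have x: "x \<in> Arr C"
    using I by (simp add: x_def h.tensor_simps)
  define I3 where "I3 = I \<otimes>\<^bsub>H\<^esub> (I \<otimes>\<^bsub>H\<^esub> I)"
  define I4 where "I4 = I \<otimes>\<^bsub>H\<^esub> I3"
  \<comment> \<open>The object whose identity is the block that \<open>frame_split\<close> attaches
    on the right of the frame.\<close>
  define P where "P = I3 \<otimes>\<^bsub>V\<^esub> (I \<otimes>\<^bsub>V\<^esub> I3)"
  have unital_P: "unital I3" "unital I4" "unital P"
    by (simp_all add: I3_def I4_def P_def unital_I unital_h unital_v)
  then have obs: "I3 \<in> Obj C" "I4 \<in> Obj C" "P \<in> Obj C"
    by (simp_all add: unital_def)
  have x3: "x \<odot>\<^bsub>H\<^esub> (x \<odot>\<^bsub>H\<^esub> x) = Ident C I3"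
    using I by (simp add: x_def I3_def h.tensor_simps)
  have x4: "x \<odot>\<^bsub>H\<^esub> (x \<odot>\<^bsub>H\<^esub> (x \<odot>\<^bsub>H\<^esub> x)) = Ident C I4"
    unfolding x3 using I obs by (simp add: x_def I4_def h.tensor_simps)

  \<comment> \<open>From the inside out: right and left borders, then bottom and top rows. This
    order reproduces the bracketing of \<open>frame\<close>, so \<open>S_frame\<close> holds by
    unfolding.\<close>
  define S where "S = comp_functor (tensor_left C V I4) (comp_functor (tensor_right C V I4)
      (comp_functor (tensor_left C H I) (tensor_right C H I)))"
  have S: "fully_faithful C C S"
    unfolding S_def by (intro fully_faithful_comp[where D = C] ff_h ff_v unital_P unital_I)
  then interpret S: is_functor C C S
    by (simp add: fully_faithful_def)
  have S_frame: "ar_map S f = arrows.frame x f" for f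
    by (simp add: S_def comp_functor_def tensor_left_def tensor_right_def arrows.frame_def x4
        x_def[symmetric])
  have S_ar: "ar_map S f \<in> Arr C" "Dom C (ar_map S f) = ob_map S (Dom C f)"
    "Cod C (ar_map S f) = ob_map S (Cod C f)" if "f \<in> Arr C" for f
    using S.ar_map_in[OF that] by (simp_all add: Hom_def)

  show ?thesis
  proof (rule h.symmetry_of_fully_faithful[OF S])
    fix f Z
    assume f: "f \<in> Arr C" and Z: "Z \<in> Obj C"
      and Sf: "ar_map S f = Ident C (ob_map S (Dom C f))"
      and ob: "ob_map S (Dom C f \<otimes>\<^bsub>H\<^esub> Z) = ob_map S (Cod C f \<otimes>\<^bsub>H\<^esub> Z)"
    let ?k = "ar_map S (f \<odot>\<^bsub>H\<^esub> Ident C Z)" and ?X = "ob_map S (Dom C f \<otimes>\<^bsub>H\<^esub> Z)"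
    \<comment> \<open>The block \<open>P\<close> with \<open>Z\<close> inserted in its middle row:
      where \<open>frame_split\<close> moves \<open>Z\<close> once the frame is closed around
      \<open>f\<close>.\<close>
    let ?Q = "I3 \<otimes>\<^bsub>V\<^esub> ((Z \<otimes>\<^bsub>H\<^esub> I) \<otimes>\<^bsub>V\<^esub> I3)"
    have k: "?k \<in> Arr C" "Dom C ?k = ?X" "Cod C ?k = ?X"
      using f Z ob by (simp_all add: S_ar h.tensor_simps)
    have X: "?X \<in> Obj C"
      using k h.cod.Dom_in by force
    have Q: "?Q \<in> Obj C"
      using Z I obs by (simp add: h.tensor_simps v.tensor_simps)
    have P_ar: "Ident C I3 \<odot>\<^bsub>V\<^esub> (x \<odot>\<^bsub>V\<^esub> Ident C I3) = Ident C P"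
      using I obs by (simp add: x_def P_def v.tensor_simps)
    have Q_ar: "Ident C I3 \<odot>\<^bsub>V\<^esub> ((Ident C Z \<odot>\<^bsub>H\<^esub> x) \<odot>\<^bsub>V\<^esub> Ident C I3) = Ident C ?Q"
      using I Z obs by (simp add: x_def h.tensor_simps v.tensor_simps)
    \<comment> \<open>With \<open>Z\<close> outside the frame, the hypothesis on
      \<open>ar_map S f\<close> applies and makes the whole product an identity.\<close>
    have "?k \<odot>\<^bsub>H\<^esub> Ident C P = ar_map S f \<odot>\<^bsub>H\<^esub> Ident C ?Q"
      using arrows.frame_split[OF x f h.cod.Ident_in[OF Z]]
      by (simp add: S_frame x3 P_ar Q_ar)
    also have "\<dots> = Ident C (ob_map S (Dom C f) \<otimes>\<^bsub>H\<^esub> ?Q)"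
      unfolding Sf using f Q by (simp add: h.tensor_simps S.ob_map_in h.cod.Dom_in)
    finally have eq: "?k \<odot>\<^bsub>H\<^esub> Ident C P = Ident C (ob_map S (Dom C f) \<otimes>\<^bsub>H\<^esub> ?Q)" .
    \<comment> \<open>Comparing domains shows that this identity lives at \<open>?X\<close> tensored
      with \<open>P\<close>, so that it splits as a tensor of identities.\<close>
    have "?X \<otimes>\<^bsub>H\<^esub> P = ob_map S (Dom C f) \<otimes>\<^bsub>H\<^esub> ?Q"
      using arg_cong[OF eq, of "Dom C"] k f Q obs
      by (simp add: h.tensor_simps S.ob_map_in h.cod.Dom_in)
    with eq have "?k \<odot>\<^bsub>H\<^esub> Ident C P = Ident C ?X \<odot>\<^bsub>H\<^esub> Ident C P"
      using X obs by (simp add: h.tensor_simps)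
    \<comment> \<open>\<open>P\<close> is \<open>unital\<close>, so tensoring with it on the right
      is faithful and can be cancelled.\<close>
    moreover have "inj_on (ar_map (tensor_right C H P)) (Hom C ?X ?X)"
      using ff_h(2)[OF unital_P(3)] X by (simp add: fully_faithful_def bij_betw_def)
    ultimately show "?k = Ident C ?X"
      using k X by (simp add: inj_on_def tensor_right_def Hom_def h.tensor_simps)
  qed (unfold S_frame, (rule arrows.frame_commute[OF x] arrows.frame_commute_left[OF x]; assumption)+)
qed

end

theorem proposition3p2:
  fixes C :: "('o, 'a) category" and H V :: "('o, 'a) tensor"
  assumes "two_fold_monoidal C H V"
  shows "\<exists>\<sigma>. symmetry C H \<sigma> \<and> (\<forall>X \<in> Obj C. \<sigma> (X, X) = Ident C (X \<otimes>\<^bsub>H\<^esub> X))"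
  using assms by (rule two_fold_monoidal.degenerate_symmetric)

end
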